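(* Let $C$ be a fixed conic in the complex projective plane $\mathbb{CP}^2$. Suppose $C$ contains distinct points $a,b$. Let $m$ be any point on $ab$ which is not equal to $a$ or $b$. Let $rs$ and $fg$ be any chords of $C$ which contain $m$. Let $i=rg\cap ab$ and $j=fs\cap ab$. If $p$ is chosen on $ab$ so that $cr(pamb)=-1$, then $cr(pjmi)=-1$ as well.
   Context: For points $x,y$, $xy$ denotes the projective line through them, and $\cap$ denotes the intersection point of two lines. A chord $xy$ of $C$ is the line through two points $x,y$ of $C$. For points $w,x,y,z$ of a projective line, $cr(wxyz)$ denotes their cross ratio, given in an affine coordinate on the line (with the usual conventions at $\infty$) by $cr(wxyz)=\frac{(w-x)(y-z)}{(w-z)(y-x)}$. *)

theory Defs
  imports "HOL-Analysis.Analysis"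
begin

definition proportional :: "complex^3 \<Rightarrow> complex^3 \<Rightarrow> bool" where
  "proportional x y \<longleftrightarrow> x \<noteq> 0 \<and> y \<noteq> 0 \<and> (\<exists>c. y = c *s x)"

lemma part_equivp_proportional: "part_equivp proportional"
proof (rule part_equivpI)
  have "proportional (axis 1 1) (axis 1 1)"
    unfolding proportional_def by (auto simp: axis_eq_0_iff intro: exI[of _ 1])
  then show "\<exists>x. proportional x x" by blast
  show "symp proportional"
  proof (rule sympI)
    fix x y assume xy: "proportional x y"
    then obtain c where c: "y = c *s x" "x \<noteq> 0" "y \<noteq> 0"
      by (auto simp: proportional_def)
    then have "c \<noteq> 0" by auto
    then have "x = inverse c *s y" using c by (simp add: vector_smult_assoc)
    then show "proportional y x" using c(2,3) unfolding proportional_def by blast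
  qed
  show "transp proportional"
    by (rule transpI) (auto simp: proportional_def vector_smult_assoc)
qed

quotient_type cp2 = "complex^3" / partial: proportional
  by (rule part_equivp_proportional)

lemma span_scale_pair:
  fixes x y :: "complex^3"
  assumes "c \<noteq> 0" "d \<noteq> 0"
  shows "vec.span {c *s x, d *s y} = vec.span {x, y}"
proof (rule subset_antisym)
  show "vec.span {c *s x, d *s y} \<subseteq> vec.span {x, y}"
    by (rule vec.span_minimal) (auto intro: vec.span_scale vec.span_base)
  have *: "x = inverse c *s (c *s x)" "y = inverse d *s (d *s y)"
    using assms by (simp_all add: vector_smult_assoc)
  have "x \<in> vec.span {c *s x, d *s y}"
    by (subst (1) *(1), rule vec.span_scale, rule vec.span_base) simp
  moreover have "y \<in> vec.span {c *s x, d *s y}"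
    by (subst (1) *(2), rule vec.span_scale, rule vec.span_base) simp
  ultimately show "vec.span {x, y} \<subseteq> vec.span {c *s x, d *s y}"
    by (intro vec.span_minimal) auto
qed

lift_definition in_join :: "cp2 \<Rightarrow> cp2 \<Rightarrow> cp2 \<Rightarrow> bool"
  is "\<lambda>x y z. z \<in> vec.span {x, y}"
proof -
  fix x x' y y' z z' :: "complex^3"
  assume "proportional x x'" "proportional y y'" "proportional z z'"
  then obtain a b c where *: "x' = a *s x" "y' = b *s y" "z' = c *s z" "a \<noteq> 0" "b \<noteq> 0" "c \<noteq> 0"
    unfolding proportional_def by (metis vector_smult_lzero)
  have "z' \<in> vec.span {x, y} \<longleftrightarrow> z \<in> vec.span {x, y}"
    unfolding *(3)
  proof
    assume "c *s z \<in> vec.span {x, y}"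
    then have "inverse c *s (c *s z) \<in> vec.span {x, y}" by (rule vec.span_scale)
    then show "z \<in> vec.span {x, y}" using *(6) by (simp add: vector_smult_assoc)
  qed (rule vec.span_scale)
  then show "z \<in> vec.span {x, y} \<longleftrightarrow> z' \<in> vec.span {x', y'}"
    using * by (simp add: span_scale_pair)
qed

text \<open>This is a projective line only if \<open>x \<noteq> y\<close>; for \<open>x = y\<close> it is the single point \<open>x\<close>.\<close>

definition pline :: "cp2 \<Rightarrow> cp2 \<Rightarrow> cp2 set" where
  "pline x y = {z. in_join x y z}"

lift_definition on_quadric :: "complex^3^3 \<Rightarrow> cp2 \<Rightarrow> bool"
  is "\<lambda>A x. (\<Sum>i\<in>UNIV. \<Sum>j\<in>UNIV. A $ i $ j * x $ i * x $ j) = 0"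
proof -
  fix A :: "complex^3^3" and x x' :: "complex^3"
  assume "proportional x x'"
  then obtain c where c: "x' = c *s x" "c \<noteq> 0"
    unfolding proportional_def by (metis vector_smult_lzero)
  have "(\<Sum>i\<in>UNIV. \<Sum>j\<in>UNIV. A $ i $ j * x' $ i * x' $ j) =
        c\<^sup>2 * (\<Sum>i\<in>UNIV. \<Sum>j\<in>UNIV. A $ i $ j * x $ i * x $ j)"
    by (simp add: c(1) sum_distrib_left power2_eq_square algebra_simps)
  then show "(\<Sum>i\<in>UNIV. \<Sum>j\<in>UNIV. A $ i $ j * x $ i * x $ j) = 0 \<longleftrightarrow>
        (\<Sum>i\<in>UNIV. \<Sum>j\<in>UNIV. A $ i $ j * x' $ i * x' $ j) = 0"
    using c(2) by simp
qed

text \<open>Conics are nondegenerate: line pairs and double lines are excluded.\<close>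

definition conic :: "cp2 set \<Rightarrow> bool" where
  "conic C \<longleftrightarrow> (\<exists>A. transpose A = A \<and> det A \<noteq> 0 \<and> C = {x. on_quadric A x})"

text \<open>A basis \<open>u, v\<close> of the plane over a projective line gives the point
  \<open>[\<sigma> u + \<tau> v]\<close> the affine coordinate \<open>\<sigma> / \<tau>\<close>, with \<open>[u]\<close> at infinity.
  The functions \<open>\<sigma>\<close>, \<open>\<tau>\<close> pick homogeneous coordinates of the points of \<open>S\<close>.\<close>

definition line_coords ::
    "complex^3 \<Rightarrow> complex^3 \<Rightarrow> (cp2 \<Rightarrow> complex) \<Rightarrow> (cp2 \<Rightarrow> complex) \<Rightarrow> cp2 set \<Rightarrow> bool" where
  "line_coords u v \<sigma> \<tau> S \<longleftrightarrow>
     (\<forall>\<alpha> \<beta>. \<alpha> *s u + \<beta> *s v = 0 \<longrightarrow> \<alpha> = 0 \<and> \<beta> = 0) \<and>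
     (\<forall>q\<in>S. (\<sigma> q \<noteq> 0 \<or> \<tau> q \<noteq> 0) \<and> q = abs_cp2 (\<sigma> q *s u + \<tau> q *s v))"

text \<open>Each difference \<open>q - q'\<close> of affine coordinates in
  \<open>(w - x) (y - z) / ((w - z) (y - x))\<close> becomes the determinant
  \<open>\<sigma> q * \<tau> q' - \<sigma> q' * \<tau> q\<close>; the factors \<open>\<tau>\<close> cancel, so the formula also covers
  points at infinity. Totality of division gives \<open>0\<close> in place of the value infinity.\<close>

definition coord_ratio ::
    "(cp2 \<Rightarrow> complex) \<Rightarrow> (cp2 \<Rightarrow> complex) \<Rightarrow> cp2 \<Rightarrow> cp2 \<Rightarrow> cp2 \<Rightarrow> cp2 \<Rightarrow> complex" where
  "coord_ratio \<sigma> \<tau> w x y z =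
     (let d = (\<lambda>q q'. \<sigma> q * \<tau> q' - \<sigma> q' * \<tau> q)
      in (d w x * d y z) / (d w z * d y x))"

definition cross_ratio :: "cp2 \<Rightarrow> cp2 \<Rightarrow> cp2 \<Rightarrow> cp2 \<Rightarrow> complex" where
  "cross_ratio w x y z =
     (THE c. \<exists>u v \<sigma> \<tau>. line_coords u v \<sigma> \<tau> {w, x, y, z} \<and> c = coord_ratio \<sigma> \<tau> w x y z)"

lemma abs_cp2_eq_iff:
  assumes "x \<noteq> 0" "y \<noteq> 0"
  shows "abs_cp2 x = abs_cp2 y \<longleftrightarrow> (\<exists>c. c \<noteq> 0 \<and> y = c *s x)"
proof -
  have "proportional x x" "proportional y y"
    using assms unfolding proportional_def by (metis vector_smult_lid)+
  then have "abs_cp2 x = abs_cp2 y \<longleftrightarrow> proportional x y"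
    using Quotient3_rel[OF Quotient3_cp2] by blast
  also have "\<dots> \<longleftrightarrow> (\<exists>c. c \<noteq> 0 \<and> y = c *s x)"
    using assms unfolding proportional_def by (metis vector_smult_lzero)
  finally show ?thesis .
qed

lemma independent_minor:
  fixes u v :: "complex^3"
  assumes "\<forall>\<alpha> \<beta>. \<alpha> *s u + \<beta> *s v = 0 \<longrightarrow> \<alpha> = 0 \<and> \<beta> = 0"
  shows "\<exists>k l. u $ k * v $ l - u $ l * v $ k \<noteq> 0"
proof (rule ccontr)
  assume "\<not> ?thesis"
  then have *: "u $ k * v $ l = u $ l * v $ k" for k l by auto
  have "u $ k = 0" for k
  proof -
    have "v $ k *s u + (- (u $ k)) *s v = 0"
      by (simp add: vec_eq_iff * mult.commute[of "v $ k"])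
    then show ?thesis using assms by fastforce
  qed
  then have "1 *s u + 0 *s v = 0" by (simp add: vec_eq_iff)
  then show False using assms by fastforce
qed

lemma coord_ratio_unique:
  assumes "line_coords u v \<sigma> \<tau> {w, x, y, z}" "line_coords u' v' \<sigma>' \<tau>' {w, x, y, z}"
  shows "coord_ratio \<sigma> \<tau> w x y z = coord_ratio \<sigma>' \<tau>' w x y z"
proof -
  let ?S = "{w, x, y, z}"
  define d where "d q q' = \<sigma> q * \<tau> q' - \<sigma> q' * \<tau> q" for q q'
  define d' where "d' q q' = \<sigma>' q * \<tau>' q' - \<sigma>' q' * \<tau>' q" for q q'
  define W where "W k l = u $ k * v $ l - u $ l * v $ k" for k l
  define W' where "W' k l = u' $ k * v' $ l - u' $ l * v' $ k" for k l
  have "\<exists>c. c \<noteq> 0 \<and> \<sigma>' q *s u' + \<tau>' q *s v' = c *s (\<sigma> q *s u + \<tau> q *s v)" if "q \<in> ?S" for q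
  proof -
    have "\<sigma> q *s u + \<tau> q *s v \<noteq> 0" "\<sigma>' q *s u' + \<tau>' q *s v' \<noteq> 0"
      "abs_cp2 (\<sigma> q *s u + \<tau> q *s v) = abs_cp2 (\<sigma>' q *s u' + \<tau>' q *s v')"
      using assms that unfolding line_coords_def by metis+
    then show ?thesis using abs_cp2_eq_iff by blast
  qed
  then obtain c where c: "\<And>q. q \<in> ?S \<Longrightarrow> c q \<noteq> 0"
    "\<And>q. q \<in> ?S \<Longrightarrow> \<sigma>' q *s u' + \<tau>' q *s v' = c q *s (\<sigma> q *s u + \<tau> q *s v)"
    by metis
  have key: "d' q q' * W' k l = c q * c q' * (d q q' * W k l)" if "q \<in> ?S" "q' \<in> ?S" for q q' k l
  proof -
    have e: "\<sigma>' q * u' $ k + \<tau>' q * v' $ k = c q * (\<sigma> q * u $ k + \<tau> q * v $ k)"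
      if "q \<in> ?S" for q k
      using arg_cong[OF c(2)[OF that], of "\<lambda>V. V $ k"]
      by (simp only: vector_add_component vector_smult_component)
    note e1 = e[OF that(1)] and e2 = e[OF that(2)]
    have "d' q q' * W' k l =
        (\<sigma>' q * u' $ k + \<tau>' q * v' $ k) * (\<sigma>' q' * u' $ l + \<tau>' q' * v' $ l) -
        (\<sigma>' q * u' $ l + \<tau>' q * v' $ l) * (\<sigma>' q' * u' $ k + \<tau>' q' * v' $ k)"
      unfolding d'_def W'_def by (simp add: algebra_simps)
    also have "\<dots> = c q * c q' * (d q q' * W k l)"
      unfolding e1 e2 d_def W_def by (simp add: algebra_simps)
    finally show ?thesis .
  qed
  obtain k l where kl: "W k l \<noteq> 0"
    using independent_minor assms(1) unfolding line_coords_def W_def by blast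
  obtain k' l' where kl': "W' k' l' \<noteq> 0"
    using independent_minor assms(2) unfolding line_coords_def W'_def by blast
  have goal: "(d w x * d y z) / (d w z * d y x) = (d' w x * d' y z) / (d' w z * d' y x)"
  proof (cases "W' k l = 0")
    case True
    then have "d q q' = 0" if "q \<in> ?S" "q' \<in> ?S" for q q'
      using key[OF that, of k l] c(1) that kl by simp
    moreover from this have "d' q q' = 0" if "q \<in> ?S" "q' \<in> ?S" for q q'
      using key[OF that, of k' l'] that kl' by simp
    ultimately show ?thesis by simp
  next
    case False
    define e where "e = W k l / W' k l"
    have "e \<noteq> 0" using kl False by (simp add: e_def)
    have d': "d' q q' = c q * c q' * e * d q q'" if "q \<in> ?S" "q' \<in> ?S" for q q'
      using key[OF that, of k l] False by (simp add: e_def field_simps)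
    define h where "h = c w * c x * c y * c z * e * e"
    have "h \<noteq> 0" using c(1) \<open>e \<noteq> 0\<close> by (simp add: h_def)
    have "d' w x * d' y z = h * (d w x * d y z)" "d' w z * d' y x = h * (d w z * d y x)"
      by (simp_all add: d' h_def)
    then show ?thesis using \<open>h \<noteq> 0\<close> by simp
  qed
  then show ?thesis unfolding coord_ratio_def d_def d'_def by (simp add: Let_def)
qed

lemma cross_ratio_eq:
  assumes "line_coords u v \<sigma> \<tau> {w, x, y, z}"
  shows "cross_ratio w x y z = coord_ratio \<sigma> \<tau> w x y z"
  unfolding cross_ratio_def
proof (rule the_equality)
  show "\<exists>u v \<sigma>' \<tau>'. line_coords u v \<sigma>' \<tau>' {w, x, y, z} \<and>
      coord_ratio \<sigma> \<tau> w x y z = coord_ratio \<sigma>' \<tau>' w x y z"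
    using assms by (intro exI conjI) (assumption, rule refl)
qed (elim exE conjE, simp only: coord_ratio_unique[OF _ assms])

lemma cross_ratio_affine:
  assumes uv: "\<forall>\<alpha> \<beta>. \<alpha> *s u + \<beta> *s v = 0 \<longrightarrow> \<alpha> = 0 \<and> \<beta> = 0"
  defines "P \<equiv> \<lambda>c. abs_cp2 (c *s u + v)"
  shows "cross_ratio (P w) (P x) (P y) (P z) = ((w - x) * (y - z)) / ((w - z) * (y - x))"
    and "cross_ratio (abs_cp2 u) (P x) (P y) (P z) = (y - z) / (y - x)"
proof -
  have nz: "c *s u + v \<noteq> 0" for c
    using uv[rule_format, of c 1] by auto
  have u: "u \<noteq> 0" using uv[rule_format, of 1 0] by auto
  have inj: "c = c'" if eq: "P c = P c'" for c c'
  proof -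
    obtain k where "c' *s u + v = k *s (c *s u + v)"
      using eq abs_cp2_eq_iff[OF nz nz, of c c'] unfolding P_def by metis
    moreover have "(c' - k * c) *s u + (1 - k) *s v = (c' *s u + v) - k *s (c *s u + v)"
      by (simp add: vec_eq_iff algebra_simps)
    ultimately have "(c' - k * c) *s u + (1 - k) *s v = 0" by (simp only: diff_self)
    then have "c' - k * c = 0 \<and> 1 - k = 0" using uv by blast
    then show ?thesis by simp
  qed
  have ninf: "P c \<noteq> abs_cp2 u" for c
  proof
    assume "P c = abs_cp2 u"
    then obtain k where k: "u = k *s (c *s u + v)" "k \<noteq> 0"
      using abs_cp2_eq_iff[OF nz u] unfolding P_def by metis
    have "(1 - k * c) *s u + (- k) *s v = u - k *s (c *s u + v)"
      by (simp add: vec_eq_iff algebra_simps)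
    also have "\<dots> = 0" using k(1) by (simp only: right_minus_eq)
    finally have "(1 - k * c) *s u + (- k) *s v = 0" .
    then have "1 - k * c = 0 \<and> - k = 0" using uv by blast
    then show False using \<open>k \<noteq> 0\<close> by simp
  qed
  define \<sigma> where "\<sigma> q = (if q = abs_cp2 u then 1 else THE c. q = P c)" for q
  define \<tau> :: "cp2 \<Rightarrow> complex" where "\<tau> q = (if q = abs_cp2 u then 0 else 1)" for q
  have s: "\<sigma> (P c) = c" "\<tau> (P c) = 1" "\<sigma> (abs_cp2 u) = 1" "\<tau> (abs_cp2 u) = 0" for c
    using inj ninf by (auto simp: \<sigma>_def \<tau>_def)
  have "line_coords u v \<sigma> \<tau> {P w, P x, P y, P z}"
    "line_coords u v \<sigma> \<tau> {abs_cp2 u, P x, P y, P z}"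
    unfolding line_coords_def using uv by (simp_all only: ball_simps s, simp_all add: P_def)
  then show "cross_ratio (P w) (P x) (P y) (P z) = ((w - x) * (y - z)) / ((w - z) * (y - x))"
    and "cross_ratio (abs_cp2 u) (P x) (P y) (P z) = (y - z) / (y - x)"
    by (simp_all add: cross_ratio_eq coord_ratio_def s Let_def)
qed

text \<open>Four collinear points have a cross ratio, finite or infinite, unless three of them coincide;
  in that case the formula reads \<open>0 / 0\<close>.\<close>

definition cross_ratio_defined :: "cp2 \<Rightarrow> cp2 \<Rightarrow> cp2 \<Rightarrow> cp2 \<Rightarrow> bool" where
  "cross_ratio_defined w x y z \<longleftrightarrow>
     \<not> (w = x \<and> x = y) \<and> \<not> (w = x \<and> x = z) \<and> \<not> (w = y \<and> y = z) \<and> \<not> (x = y \<and> y = z)"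

end

theory Submission imports Defs begin

text \<open>Scale representatives so that \<open>m = A + B\<close>. With \<open>Q\<close> the bilinear form of the conic,
  \<open>Q A A = Q B B = 0\<close> and nondegeneracy give \<open>Q m m \<noteq> 0\<close>, so the harmonic homology
  \<open>h X = X - (2 Q X m / Q m m) m\<close> exists. It preserves the conic and every line through \<open>m\<close>, hence
  swaps \<open>r\<close> with \<open>s\<close> and \<open>f\<close> with \<open>g\<close>, and sends \<open>A\<close> to \<open>- B\<close>. Thus it maps \<open>i\<close>, on \<open>rg\<close>, to the
  point \<open>j\<close>, on \<open>sf\<close>; on \<open>ab\<close> it exchanges the coordinates with respect to \<open>A, B\<close>, so \<open>i, j\<close> are
  harmonic with respect to the fixed points \<open>A + B = m\<close> and \<open>A - B = p\<close>.\<close>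

section \<open>Homogeneous coordinates of points, lines and cross ratios\<close>

lemma vec_span_pair:
  fixes x y :: "complex^3"
  shows "z \<in> vec.span {x, y} \<longleftrightarrow> (\<exists>\<alpha> \<beta>. z = \<alpha> *s x + \<beta> *s y)"
proof
  assume "z \<in> vec.span {x, y}"
  then obtain \<alpha> where "z - \<alpha> *s x \<in> vec.span {y}"
    by (auto simp: vec.span_insert)
  then obtain \<beta> where "z - \<alpha> *s x = \<beta> *s y"
    by (auto simp: vec.span_singleton)
  then have "z = \<alpha> *s x + \<beta> *s y" by (metis diff_eq_eq add.commute)
  then show "\<exists>\<alpha> \<beta>. z = \<alpha> *s x + \<beta> *s y" by blast
qed (auto intro: vec.span_add vec.span_scale vec.span_base)

lemma proportional_refl: "x \<noteq> 0 \<Longrightarrow> proportional x x"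
  unfolding proportional_def by (metis vector_smult_lid)

text \<open>Since \<open>proportional\<close> is only a partial equivalence, reflexivity at the
  chosen representative is what excludes the zero vector.\<close>

lemma cp2_rep:
  obtains x where "x \<noteq> 0" "q = abs_cp2 x"
proof -
  have "proportional (rep_cp2 q) (rep_cp2 q)" "abs_cp2 (rep_cp2 q) = q"
    using Quotient3_rep_reflp[OF Quotient3_cp2] Quotient3_abs_rep[OF Quotient3_cp2] by blast+
  then show ?thesis using that[of "rep_cp2 q"] by (auto simp: proportional_def)
qed

lemma abs_cp2_scale:
  assumes "x \<noteq> 0" "c \<noteq> 0"
  shows "abs_cp2 (c *s x) = abs_cp2 x"
proof -
  have "c *s x \<noteq> 0" using assms by auto
  then show ?thesis using abs_cp2_eq_iff[OF assms(1)] assms(2) by metis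
qed

lemma mem_pline_abs:
  assumes "x \<noteq> 0" "y \<noteq> 0" "z \<noteq> 0"
  shows "abs_cp2 z \<in> pline (abs_cp2 x) (abs_cp2 y) \<longleftrightarrow> (\<exists>\<alpha> \<beta>. z = \<alpha> *s x + \<beta> *s y)"
  unfolding pline_def
  by (simp add: in_join.abs_eq proportional_refl assms vec_span_pair)

lemma independent_of_ne:
  assumes "x \<noteq> 0" "y \<noteq> 0" "abs_cp2 x \<noteq> abs_cp2 y"
  shows "\<forall>\<alpha> \<beta>. \<alpha> *s x + \<beta> *s y = 0 \<longrightarrow> \<alpha> = 0 \<and> \<beta> = 0"
proof (intro allI impI)
  fix \<alpha> \<beta> assume eq: "\<alpha> *s x + \<beta> *s y = 0"
  have "\<beta> = 0"
  proof (rule ccontr)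
    assume "\<beta> \<noteq> 0"
    have "y = inverse \<beta> *s (\<beta> *s y)" using \<open>\<beta> \<noteq> 0\<close> by (simp add: vector_smult_assoc)
    also have "\<beta> *s y = (- \<alpha>) *s x" using eq by (simp add: add_eq_0_iff)
    finally have y: "y = (inverse \<beta> * (- \<alpha>)) *s x" by (simp only: vector_smult_assoc)
    then have "inverse \<beta> * (- \<alpha>) \<noteq> 0" using assms(2) by (metis vector_smult_lzero)
    then show False using abs_cp2_scale[OF assms(1)] y assms(3) by metis
  qed
  then show "\<alpha> = 0 \<and> \<beta> = 0" using eq assms(1) by simp
qed

lemma abs_cp2_coords_eq:
  assumes uv: "\<forall>\<alpha> \<beta>. \<alpha> *s u + \<beta> *s v = 0 \<longrightarrow> \<alpha> = 0 \<and> \<beta> = 0"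
    and nz: "x \<noteq> 0 \<or> y \<noteq> 0" "x' \<noteq> 0 \<or> y' \<noteq> 0"
    and eq: "abs_cp2 (x *s u + y *s v) = abs_cp2 (x' *s u + y' *s v)"
  obtains c where "c \<noteq> 0" "x' = c * x" "y' = c * y"
proof -
  have "x *s u + y *s v \<noteq> 0" "x' *s u + y' *s v \<noteq> 0" using uv nz by blast+
  then obtain c where c: "c \<noteq> 0" "x' *s u + y' *s v = c *s (x *s u + y *s v)"
    using abs_cp2_eq_iff eq by blast
  have "(x' - c * x) *s u + (y' - c * y) *s v = (x' *s u + y' *s v) - c *s (x *s u + y *s v)"
    by (simp add: vec_eq_iff algebra_simps)
  also have "\<dots> = 0" using c(2) by (simp only: diff_self)
  finally have "x' - c * x = 0 \<and> y' - c * y = 0" using uv by blast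
  then show ?thesis using that[OF c(1)] by simp
qed

text \<open>Passing to other homogeneous coordinates multiplies each point's pair by a nonzero
  factor. Each of the four points enters numerator and denominator exactly once, so the factors
  cancel. Points at infinity and coinciding points are covered.\<close>

lemma cross_ratio_coords:
  assumes uv: "\<forall>\<alpha> \<beta>. \<alpha> *s u + \<beta> *s v = 0 \<longrightarrow> \<alpha> = 0 \<and> \<beta> = 0"
    and nz: "w \<noteq> 0 \<or> w' \<noteq> 0" "x \<noteq> 0 \<or> x' \<noteq> 0" "y \<noteq> 0 \<or> y' \<noteq> 0" "z \<noteq> 0 \<or> z' \<noteq> 0"
  defines "P \<equiv> \<lambda>c d. abs_cp2 (c *s u + d *s v)"
  shows "cross_ratio (P w w') (P x x') (P y y') (P z z') =
    ((w * x' - x * w') * (y * z' - z * y')) / ((w * z' - z * w') * (y * x' - x * y'))"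
proof -
  \<comment> \<open>\<open>line_coords\<close> wants coordinates as functions of the point, but
    coinciding points may be given by different pairs. Hence one pair per point is chosen, and only
    its proportionality to the given pair is used.\<close>
  define good where "good q st \<longleftrightarrow> (fst st \<noteq> 0 \<or> snd st \<noteq> 0) \<and> q = P (fst st) (snd st)" for q st
  define \<sigma> where "\<sigma> q = fst (SOME st. good q st)" for q
  define \<tau> where "\<tau> q = snd (SOME st. good q st)" for q
  have st: "(\<sigma> (P c d) \<noteq> 0 \<or> \<tau> (P c d) \<noteq> 0) \<and> P c d = P (\<sigma> (P c d)) (\<tau> (P c d))"
    if "c \<noteq> 0 \<or> d \<noteq> 0" for c d
  proof -
    have "good (P c d) (c, d)" using that by (simp add: good_def)
    then have "good (P c d) (SOME st. good (P c d) st)" by (rule someI)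
    then show ?thesis by (simp add: good_def \<sigma>_def \<tau>_def)
  qed
  have scale: "\<exists>k. k \<noteq> 0 \<and> \<sigma> (P c d) = k * c \<and> \<tau> (P c d) = k * d" if "c \<noteq> 0 \<or> d \<noteq> 0" for c d
    using abs_cp2_coords_eq[OF uv that] st[OF that] unfolding P_def by metis
  obtain kw where kw: "kw \<noteq> 0" "\<sigma> (P w w') = kw * w" "\<tau> (P w w') = kw * w'"
    using scale[OF nz(1)] by blast
  obtain kx where kx: "kx \<noteq> 0" "\<sigma> (P x x') = kx * x" "\<tau> (P x x') = kx * x'"
    using scale[OF nz(2)] by blast
  obtain ky where ky: "ky \<noteq> 0" "\<sigma> (P y y') = ky * y" "\<tau> (P y y') = ky * y'"
    using scale[OF nz(3)] by blast
  obtain kz where kz: "kz \<noteq> 0" "\<sigma> (P z z') = kz * z" "\<tau> (P z z') = kz * z'"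
    using scale[OF nz(4)] by blast
  have "line_coords u v \<sigma> \<tau> {P w w', P x x', P y y', P z z'}"
    unfolding line_coords_def using uv st[OF nz(1)] st[OF nz(2)] st[OF nz(3)] st[OF nz(4)]
    unfolding P_def by blast
  then have "cross_ratio (P w w') (P x x') (P y y') (P z z') =
      ((kw * w * (kx * x') - kx * x * (kw * w')) * (ky * y * (kz * z') - kz * z * (ky * y'))) /
      ((kw * w * (kz * z') - kz * z * (kw * w')) * (ky * y * (kx * x') - kx * x * (ky * y')))"
    by (simp only: cross_ratio_eq coord_ratio_def Let_def kw kx ky kz)
  also have "\<dots> = ((kw * kx * ky * kz) * ((w * x' - x * w') * (y * z' - z * y'))) /
      ((kw * kx * ky * kz) * ((w * z' - z * w') * (y * x' - x * y')))"
    by (rule arg_cong2[of _ _ _ _ "(/)"]; algebra)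
  also have "\<dots> = ((w * x' - x * w') * (y * z' - z * y')) / ((w * z' - z * w') * (y * x' - x * y'))"
    using kw kx ky kz by (intro mult_divide_mult_cancel_left) simp
  finally show ?thesis .
qed

section \<open>The bilinear form of a conic\<close>

definition bil :: "complex^3^3 \<Rightarrow> complex^3 \<Rightarrow> complex^3 \<Rightarrow> complex" where
  "bil A x y = (\<Sum>i\<in>UNIV. \<Sum>j\<in>UNIV. A $ i $ j * x $ i * y $ j)"

lemma bil_linear:
  "bil A (x + x') y = bil A x y + bil A x' y"
  "bil A x (y + y') = bil A x y + bil A x y'"
  "bil A (c *s x) y = c * bil A x y"
  "bil A x (c *s y) = c * bil A x y"
  by (simp_all add: bil_def sum.distrib sum_distrib_left distrib_left distrib_right mult_ac)

lemma bil_sym: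
  assumes "transpose A = A"
  shows "bil A x y = bil A y x"
proof -
  have "A $ i $ j = A $ j $ i" for i j
    using arg_cong[OF assms, of "\<lambda>B. B $ j $ i"] by (simp add: transpose_def)
  then show ?thesis unfolding bil_def
    by (subst sum.swap) (simp add: mult.commute mult.left_commute)
qed

lemma on_quadric_abs: "x \<noteq> 0 \<Longrightarrow> on_quadric A (abs_cp2 x) \<longleftrightarrow> bil A x x = 0"
  by (simp add: on_quadric.abs_eq proportional_refl bil_def)

text \<open>In a basis \<open>a, b, e\<close> the Gram matrix would have a vanishing \<open>2 \<times> 2\<close> block and so determinant
  \<open>0\<close>.\<close>

lemma nondegenerate_no_isotropic_line:
  fixes A :: "complex^3^3"
  assumes sym: "transpose A = A" and "det A \<noteq> 0"
    and ab: "\<forall>\<alpha> \<beta>. \<alpha> *s a + \<beta> *s b = 0 \<longrightarrow> \<alpha> = 0 \<and> \<beta> = 0"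
    and iso: "bil A a a = 0" "bil A b b = 0"
  shows "bil A a b \<noteq> 0"
proof
  assume iso': "bil A a b = 0"
  define E where "E e = (vector [a, b, e] :: complex^3^3)" for e
  \<comment> \<open>Up to sign these determinants are the 2 by 2 minors of a, b, so some unit vector
    completes a, b to a basis.\<close>
  have "\<exists>t. det (E (axis t 1)) \<noteq> 0"
  proof (rule ccontr)
    assume "\<not> ?thesis"
    then have t: "det (E (axis t 1)) = 0" for t by blast
    have "a $ k * b $ l - a $ l * b $ k = 0" for k l
      using t[of 1] t[of 2] t[of 3] exhaust_3[of k] exhaust_3[of l]
      by (auto simp: det_3 E_def axis_def)
    then show False using independent_minor[OF ab] by blast
  qed
  then obtain e where e: "det (E e) \<noteq> 0" by blast
  have gram: "(E e ** A ** transpose (E e)) $ k $ l = bil A (E e $ k) (E e $ l)" for k l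
    by (simp add: bil_def matrix_matrix_mult_def transpose_def sum_3 algebra_simps)
  have "bil A b a = 0" using iso' bil_sym[OF sym] by metis
  \<comment> \<open>Each term of the 3 by 3 expansion takes entries of rows 1 and 2 from different
    columns, so at least one from the zero block.\<close>
  then have "det (E e ** A ** transpose (E e)) = 0"
    unfolding det_3 gram by (simp add: E_def iso iso')
  then show False using e assms(2) by (simp add: det_mul)
qed

section \<open>The harmonic homology with centre m\<close>

definition homology :: "complex^3^3 \<Rightarrow> complex^3 \<Rightarrow> complex^3 \<Rightarrow> complex^3" where
  "homology A m x = x + (- 2 * bil A x m / bil A m m) *s m"

lemma homology_linear:
  "homology A m (\<alpha> *s x + \<beta> *s y) = \<alpha> *s homology A m x + \<beta> *s homology A m y"
  by (simp add: homology_def bil_linear vec_eq_iff divide_inverse algebra_simps)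

text \<open>As r and s are isotropic, Q m m = 2 \<alpha> \<beta> Q r s and Q r m = \<beta> Q r s. So
  the image of r is r - m / \<alpha> = - (\<beta> / \<alpha>) s, and symmetrically for s. The
  explicit factors matter: for \<alpha> = \<beta> = 1 both are -1.\<close>

lemma homology_swaps:
  assumes sym: "transpose A = A" and "bil A m m \<noteq> 0"
    and "bil A r r = 0" "bil A s s = 0" and m: "m = \<alpha> *s r + \<beta> *s s"
  shows "homology A m r = (- \<beta> / \<alpha>) *s s" and "homology A m s = (- \<alpha> / \<beta>) *s r"
proof -
  have "bil A m m = 2 * \<alpha> * \<beta> * bil A r s"
    using assms(3,4) bil_sym[OF sym, of s r] by (simp add: m bil_linear)
  then have nz: "\<alpha> \<noteq> 0" "\<beta> \<noteq> 0" "bil A r s \<noteq> 0"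
    and mm: "bil A m m = 2 * \<alpha> * \<beta> * bil A r s" using assms(2) by auto
  have "bil A r m = \<beta> * bil A r s" "bil A s m = \<alpha> * bil A r s"
    using assms(3,4) bil_sym[OF sym, of s r] by (simp_all add: m bil_linear)
  then have "- 2 * bil A r m / bil A m m = - 1 / \<alpha>" "- 2 * bil A s m / bil A m m = - 1 / \<beta>"
    unfolding mm using nz by simp_all
  then show "homology A m r = (- \<beta> / \<alpha>) *s s" "homology A m s = (- \<alpha> / \<beta>) *s r"
    unfolding homology_def using nz by (simp_all add: m vec_eq_iff field_simps)
qed

theorem theorem1:
  fixes C :: "cp2 set" and a b m r s f g i j p :: cp2
  assumes "conic C"
    and "a \<in> C" and "b \<in> C" and "a \<noteq> b"
    and "m \<in> pline a b" and "m \<noteq> a" and "m \<noteq> b"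
    and "r \<in> C" and "s \<in> C" and "r \<noteq> s" and "m \<in> pline r s"
    and "f \<in> C" and "g \<in> C" and "f \<noteq> g" and "m \<in> pline f g"
    and "r \<noteq> g" and "pline r g \<inter> pline a b = {i}"
    and "f \<noteq> s" and "pline f s \<inter> pline a b = {j}"
    and "p \<in> pline a b" and "cross_ratio p a m b = -1"
    and "cross_ratio_defined p j m i"
  shows "cross_ratio p j m i = -1"
proof -
  obtain Q where sym: "transpose Q = Q" and det: "det Q \<noteq> 0" and C: "C = {x. on_quadric Q x}"
    using assms(1) by (auto simp: conic_def)
  obtain A0 where A0: "A0 \<noteq> 0" "a = abs_cp2 A0" by (rule cp2_rep)
  obtain B0 where B0: "B0 \<noteq> 0" "b = abs_cp2 B0" by (rule cp2_rep)
  obtain M where M: "M \<noteq> 0" "m = abs_cp2 M" by (rule cp2_rep)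
  obtain R where R: "R \<noteq> 0" "r = abs_cp2 R" by (rule cp2_rep)
  obtain S where S: "S \<noteq> 0" "s = abs_cp2 S" by (rule cp2_rep)
  obtain F where F: "F \<noteq> 0" "f = abs_cp2 F" by (rule cp2_rep)
  obtain G where G: "G \<noteq> 0" "g = abs_cp2 G" by (rule cp2_rep)
  obtain I where I: "I \<noteq> 0" "i = abs_cp2 I" by (rule cp2_rep)
  obtain P where P: "P \<noteq> 0" "p = abs_cp2 P" by (rule cp2_rep)
  obtain \<alpha> \<beta> where M0: "M = \<alpha> *s A0 + \<beta> *s B0"
    using assms(5) mem_pline_abs[OF A0(1) B0(1) M(1)] A0(2) B0(2) M(2) by auto
  have "\<beta> \<noteq> 0"
  proof
    assume "\<beta> = 0"
    then have "M = \<alpha> *s A0" "\<alpha> \<noteq> 0" using M0 M(1) by auto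
    then show False using abs_cp2_scale[OF A0(1)] A0(2) M(2) assms(6) by metis
  qed
  have "\<alpha> \<noteq> 0"
  proof
    assume "\<alpha> = 0"
    then have "M = \<beta> *s B0" "\<beta> \<noteq> 0" using M0 M(1) by auto
    then show False using abs_cp2_scale[OF B0(1)] B0(2) M(2) assms(7) by metis
  qed
  \<comment> \<open>This scaling gives m the coordinates (1, 1), so the homology exchanges
    coordinates on ab up to a common sign.\<close>
  define A where "A = \<alpha> *s A0"
  define B where "B = \<beta> *s B0"
  have A: "A \<noteq> 0" "a = abs_cp2 A" and B: "B \<noteq> 0" "b = abs_cp2 B"
    unfolding A_def B_def using A0 B0 \<open>\<alpha> \<noteq> 0\<close> \<open>\<beta> \<noteq> 0\<close> abs_cp2_scale by auto
  have MAB: "M = 1 *s A + 1 *s B" using M0 by (simp add: A_def B_def)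
  have ind: "\<forall>\<alpha> \<beta>. \<alpha> *s A + \<beta> *s B = 0 \<longrightarrow> \<alpha> = 0 \<and> \<beta> = 0"
    using independent_of_ne[OF A(1) B(1)] A(2) B(2) assms(4) by blast
  have isotropic: "bil Q A A = 0" "bil Q B B = 0" "bil Q R R = 0" "bil Q S S = 0"
    "bil Q F F = 0" "bil Q G G = 0"
    using assms(2,3,8,9,12,13) A B R S F G by (auto simp: C on_quadric_abs)
  have "bil Q A B \<noteq> 0"
    using nondegenerate_no_isotropic_line[OF sym det ind isotropic(1,2)] .
  then have MM: "bil Q M M \<noteq> 0"
    using isotropic bil_sym[OF sym, of B A] by (simp add: MAB bil_linear)
  let ?h = "homology Q M"
  obtain \<rho> \<rho>' where RS: "M = \<rho> *s R + \<rho>' *s S"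
    using assms(11) mem_pline_abs[OF R(1) S(1) M(1)] R(2) S(2) M(2) by auto
  obtain \<phi> \<phi>' where FG: "M = \<phi> *s F + \<phi>' *s G"
    using assms(15) mem_pline_abs[OF F(1) G(1) M(1)] F(2) G(2) M(2) by auto
  obtain \<gamma> \<gamma>' where IRG: "I = \<gamma> *s R + \<gamma>' *s G"
    using assms(17) mem_pline_abs[OF R(1) G(1) I(1)] R(2) G(2) I(2) by auto
  obtain x y where IAB: "I = x *s A + y *s B"
    using assms(17) mem_pline_abs[OF A(1) B(1) I(1)] A(2) B(2) I(2) by auto
  obtain z w where PAB: "P = z *s A + w *s B"
    using assms(20) mem_pline_abs[OF A(1) B(1) P(1)] A(2) B(2) P(2) by auto
  have xy: "x \<noteq> 0 \<or> y \<noteq> 0" and zw: "z \<noteq> 0 \<or> w \<noteq> 0" using I(1) IAB P(1) PAB by auto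

  \<comment> \<open>The candidate for j is I with its coordinates exchanged, which is minus the
    image of I. Computing that image also from R and G places it on fs.\<close>
  define J where "J = y *s A + x *s B"
  have "J \<noteq> 0" using ind xy unfolding J_def by blast
  have "?h I = x *s ((- 1) *s B) + y *s ((- 1) *s A)"
    unfolding IAB homology_linear homology_swaps[OF sym MM isotropic(1,2) MAB] by simp
  then have "J = (- 1) *s ?h I"
    by (simp add: J_def vec_eq_iff)
  also have "?h I = \<gamma> *s ((- \<rho>' / \<rho>) *s S) + \<gamma>' *s ((- \<phi> / \<phi>') *s F)"
    unfolding IRG homology_linear homology_swaps(1)[OF sym MM isotropic(3,4) RS]
      homology_swaps(2)[OF sym MM isotropic(5,6) FG] ..
  finally have "J = (\<gamma>' * (\<phi> / \<phi>')) *s F + (\<gamma> * (\<rho>' / \<rho>)) *s S"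
    by (simp add: vec_eq_iff)
  then have "abs_cp2 J \<in> pline f s"
    using mem_pline_abs[OF F(1) S(1) \<open>J \<noteq> 0\<close>] F(2) S(2) by blast
  moreover have "abs_cp2 J \<in> pline a b"
    using mem_pline_abs[OF A(1) B(1) \<open>J \<noteq> 0\<close>] A(2) B(2) J_def by blast
  ultimately have j: "j = abs_cp2 J" using assms(19) by (metis IntI singletonD)

  have pts: "a = abs_cp2 (1 *s A + 0 *s B)" "b = abs_cp2 (0 *s A + 1 *s B)"
    "m = abs_cp2 (1 *s A + 1 *s B)" "p = abs_cp2 (z *s A + w *s B)"
    "i = abs_cp2 (x *s A + y *s B)" "j = abs_cp2 (y *s A + x *s B)"
    using A B M MAB P PAB I IAB j J_def by simp_all
  have "cross_ratio p a m b = w / z"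
    unfolding pts(1-4) using zw by (subst cross_ratio_coords[OF ind]) auto
  then have "w / z = - 1" using assms(21) by simp
  \<comment> \<open>For z = 0 the quotient would be 0 by totality of division, not -1. So p is A - B
    up to scale.\<close>
  then have "z \<noteq> 0" by auto
  with \<open>w / z = - 1\<close> have "w = - z" by (simp add: divide_eq_eq)
  \<comment> \<open>x = y and x + y = 0 are the cases where i is a fixed point m or p of the
    homology. Then j = i, and three of the four points coincide, against
    \<open>cross_ratio_defined\<close>.\<close>
  have "x \<noteq> y"
  proof
    assume "x = y"
    then have "I = x *s M" "J = x *s M" "x \<noteq> 0"
      using xy by (simp_all add: IAB J_def MAB vec_eq_iff algebra_simps)
    then have "i = m" "j = m" using abs_cp2_scale[OF M(1)] I(2) j M(2) by metis+
    then show False using assms(22) by (simp add: cross_ratio_defined_def)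
  qed
  have "x + y \<noteq> 0"
  proof
    assume "x + y = 0"
    then have "y = - x" by (simp add: eq_neg_iff_add_eq_0 add.commute)
    then have "I = (x / z) *s P" "J = (- x / z) *s P" "x / z \<noteq> 0" "- x / z \<noteq> 0"
      using xy \<open>z \<noteq> 0\<close> \<open>w = - z\<close> by (auto simp: IAB J_def PAB vec_eq_iff field_simps)
    then have "i = p" "j = p" using abs_cp2_scale[OF P(1)] I(2) j P(2) by metis+
    then show False using assms(22) by (simp add: cross_ratio_defined_def)
  qed
  have "cross_ratio p j m i =
      ((z * x - y * w) * (1 * y - x * 1)) / ((z * y - x * w) * (1 * x - y * 1))"
    unfolding pts(3-6) using xy zw by (subst cross_ratio_coords[OF ind]) auto
  \<comment> \<open>With w = -z, both brackets containing p become z (x + y), which cancels.\<close>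
  also have "\<dots> = ((z * (x + y)) * (y - x)) / ((z * (x + y)) * (x - y))"
    using \<open>w = - z\<close> by (simp add: algebra_simps)
  also have "\<dots> = (y - x) / (x - y)"
    using \<open>z \<noteq> 0\<close> \<open>x + y \<noteq> 0\<close> by (intro mult_divide_mult_cancel_left) simp
  also have "\<dots> = - 1" using \<open>x \<noteq> y\<close> by (simp add: field_simps)
  finally show ?thesis .
qed

end
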